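(* For every hedonic expertise game $\mathcal{G} = (N, S, e, \kappa)$ there exists a partition $\pi$ of $N$ into coalitions of size at most $\kappa$ that is simultaneously Nash stable, core stable and Pareto optimal.
   Context: A hedonic expertise game (HEG) is $\mathcal{G} = (N, S, e, \kappa)$, where $N$ is a finite set of agents, $S$ is a finite set of skills, for each agent $i \in N$ there is a non-negative real-valued expertise function $e_i : S \to \mathbb{R}_{\ge 0}$, and $\kappa$ is a positive integer (upper bound on coalition sizes). For a nonempty $C \subseteq N$ let $E_C(s) = \max_{i \in C} e_i(s)$ and define the joint utility $U(C) = \sum_{s \in S} E_C(s)$; by convention $U(\emptyset) = 0$. A coalition is a nonempty subset of $N$ of size at most $\kappa$. A solution is a partition $\pi$ of $N$ into coalitions; all partitions considered are of this kind. For $i \in N$, $\pi(i)$ denotes the coalition of $\pi$ containing $i$, and the utility of agent $i$ in $\pi$ is $u_i(\pi) = U(\pi(i))$. A partition $\pi$ is Nash stable if for every agent $i \in N$ and every $C \in \pi$ with $|C| < \kappa$ we have $U(\pi(i)) \ge U(C \cup \{i\})$. (Moving to an empty coalition need not be considered, since $U$ is monotone.) A coalition $C$ blocks $\pi$ if $U(C) > u_i(\pi)$ for all $i \in C$. A partition $\pi$ is core stable if no coalition blocks it. A partition $\pi'$ Pareto dominates $\pi$ if $u_i(\pi') \ge u_i(\pi)$ for all $i \in N$, with strict inequality for some $i$. A partition $\pi$ is Pareto optimal if no partition $\pi'$ Pareto dominates it. *)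

theory Defs
  imports Complex_Main "HOL-Library.Disjoint_Sets"
begin

definition hedonic_expertise_game ::
    "'a set \<Rightarrow> 's set \<Rightarrow> ('a \<Rightarrow> 's \<Rightarrow> real) \<Rightarrow> nat \<Rightarrow> bool" where
  "hedonic_expertise_game N S e \<kappa> \<longleftrightarrow>
     finite N \<and> finite S \<and> (\<forall>i\<in>N. \<forall>s\<in>S. 0 \<le> e i s) \<and> 0 < \<kappa>"

(* Only meaningful for finite nonempty C. *)
definition joint_expertise :: "('a \<Rightarrow> 's \<Rightarrow> real) \<Rightarrow> 'a set \<Rightarrow> 's \<Rightarrow> real" where
  "joint_expertise e C s = Max ((\<lambda>i. e i s) ` C)"

definition joint_utility :: "'s set \<Rightarrow> ('a \<Rightarrow> 's \<Rightarrow> real) \<Rightarrow> 'a set \<Rightarrow> real" where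
  "joint_utility S e C = (if C = {} then 0 else \<Sum>s\<in>S. joint_expertise e C s)"

definition coalition :: "'a set \<Rightarrow> nat \<Rightarrow> 'a set \<Rightarrow> bool" where
  "coalition N \<kappa> C \<longleftrightarrow> C \<noteq> {} \<and> C \<subseteq> N \<and> card C \<le> \<kappa>"

definition coalition_partition :: "'a set \<Rightarrow> nat \<Rightarrow> 'a set set \<Rightarrow> bool" where
  "coalition_partition N \<kappa> \<pi> \<longleftrightarrow> partition_on N \<pi> \<and> (\<forall>C\<in>\<pi>. coalition N \<kappa> C)"

(* Only meaningful when \<pi> is a partition of a set containing i. *)
definition coalition_of :: "'a set set \<Rightarrow> 'a \<Rightarrow> 'a set" where
  "coalition_of \<pi> i = (THE C. C \<in> \<pi> \<and> i \<in> C)"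

definition agent_utility ::
    "'s set \<Rightarrow> ('a \<Rightarrow> 's \<Rightarrow> real) \<Rightarrow> 'a set set \<Rightarrow> 'a \<Rightarrow> real" where
  "agent_utility S e \<pi> i = joint_utility S e (coalition_of \<pi> i)"

(* Moving to an empty coalition is not considered: joint utility is monotone, so such
   a move never helps. *)
definition nash_stable ::
    "'a set \<Rightarrow> 's set \<Rightarrow> ('a \<Rightarrow> 's \<Rightarrow> real) \<Rightarrow> nat \<Rightarrow> 'a set set \<Rightarrow> bool" where
  "nash_stable N S e \<kappa> \<pi> \<longleftrightarrow>
     (\<forall>i\<in>N. \<forall>C\<in>\<pi>. card C < \<kappa> \<longrightarrow>
        joint_utility S e (coalition_of \<pi> i) \<ge> joint_utility S e (C \<union> {i}))"

definition blocks ::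
    "'s set \<Rightarrow> ('a \<Rightarrow> 's \<Rightarrow> real) \<Rightarrow> 'a set \<Rightarrow> 'a set set \<Rightarrow> bool" where
  "blocks S e C \<pi> \<longleftrightarrow> (\<forall>i\<in>C. joint_utility S e C > agent_utility S e \<pi> i)"

definition core_stable ::
    "'a set \<Rightarrow> 's set \<Rightarrow> ('a \<Rightarrow> 's \<Rightarrow> real) \<Rightarrow> nat \<Rightarrow> 'a set set \<Rightarrow> bool" where
  "core_stable N S e \<kappa> \<pi> \<longleftrightarrow> \<not> (\<exists>C. coalition N \<kappa> C \<and> blocks S e C \<pi>)"

definition pareto_dominates ::
    "'a set \<Rightarrow> 's set \<Rightarrow> ('a \<Rightarrow> 's \<Rightarrow> real) \<Rightarrow> 'a set set \<Rightarrow> 'a set set \<Rightarrow> bool" where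
  "pareto_dominates N S e \<pi>' \<pi> \<longleftrightarrow>
     (\<forall>i\<in>N. agent_utility S e \<pi>' i \<ge> agent_utility S e \<pi> i) \<and>
     (\<exists>i\<in>N. agent_utility S e \<pi>' i > agent_utility S e \<pi> i)"

definition pareto_optimal ::
    "'a set \<Rightarrow> 's set \<Rightarrow> ('a \<Rightarrow> 's \<Rightarrow> real) \<Rightarrow> nat \<Rightarrow> 'a set set \<Rightarrow> bool" where
  "pareto_optimal N S e \<kappa> \<pi> \<longleftrightarrow>
     \<not> (\<exists>\<pi>'. coalition_partition N \<kappa> \<pi>' \<and> pareto_dominates N S e \<pi>' \<pi>)"

end

theory Submission
  imports Defs
begin

text \<open>All members of a coalition have the same utility, so a partition whose utility profile,
  sorted in decreasing order, is lexicographically maximal has all three properties. Suppose a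
  coalition \<open>D\<close> is formed out of such a partition, where every coalition meeting \<open>D\<close> either is
  worth less than \<open>D\<close> or is contained in \<open>D\<close> and worth no more. Then only agents with
  utility below \<open>U(D)\<close> can lose, hence by maximality nobody in \<open>D\<close> gains. A blocking coalition and
  an improving move \<open>D = C \<union> {i}\<close> of a single agent are both of this kind. A Pareto improvement
  would raise the sorted profile.\<close>

text \<open>Gives real utilities natural-number ranks, used as exponents below. Strictness:
  \<open>x\<close> itself is counted for \<open>y\<close> but not for \<open>x\<close>.\<close>

lemma strict_mono_on_card_less:
  assumes "finite (V :: real set)"
  shows "strict_mono_on V (\<lambda>x. card {y \<in> V. y < x})"
proof (rule strict_mono_onI)
  fix x y assume "x \<in> V" "y \<in> V" "x < y"
  then have "{z \<in> V. z < x} \<subset> {z \<in> V. z < y}" by auto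
  then show "card {z \<in> V. z < x} < card {z \<in> V. z < y}"
    using assms by (intro psubset_card_mono) auto
qed

text \<open>Utilities are replaced by powers of \<open>card N + 1\<close> with their ranks as exponents: one gain then
  outweighs any number of losses at lower ranks, so a maximizer of the sum is lexicographically
  maximal.\<close>

lemma ex_leximax:
  fixes u :: "'p \<Rightarrow> 'a \<Rightarrow> real"
  assumes "finite N" "finite P" "P \<noteq> {}"
  shows "\<exists>p\<in>P. \<forall>q\<in>P. \<forall>j\<in>N. u p j < u q j \<longrightarrow> (\<exists>i\<in>N. u q i < u p i \<and> u q j \<le> u p i)"
proof -
  define V where "V = (\<lambda>(p, i). u p i) ` (P \<times> N)"
  define r where "r x = card {y \<in> V. y < x}" for x
  define B where "B = Suc (card N)"
  define \<Phi> where "\<Phi> p = (\<Sum>i\<in>N. B ^ r (u p i))" for p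
  have "finite V" using assms by (simp add: V_def)
  have V: "u p i \<in> V" if "p \<in> P" "i \<in> N" for p i using that by (force simp: V_def)
  have r_mono: "mono_on V r" and r_strict: "strict_mono_on V r"
    using strict_mono_on_card_less[OF \<open>finite V\<close>] strict_mono_on_imp_mono_on
    unfolding r_def by blast+
  obtain p where p: "p \<in> P" "\<And>q. q \<in> P \<Longrightarrow> \<Phi> q \<le> \<Phi> p"
    using Max_in[of "\<Phi> ` P"] Max_ge[of "\<Phi> ` P"] assms
    by (metis (no_types, lifting) finite_imageI imageE image_eqI image_is_empty)
  have "\<exists>i\<in>N. u q i < u p i \<and> u q j \<le> u p i"
    if q: "q \<in> P" and j: "j \<in> N" and gain: "u p j < u q j" for q j
  proof (rule ccontr)
    assume "\<not> ?thesis"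
    \<comment> \<open>So whoever is worse off under \<open>q\<close> had less under \<open>p\<close>
      than \<open>j\<close> gets under \<open>q\<close>: all losses start at ranks below
      \<open>r (u q j)\<close>.\<close>
    then have H: "u p i \<le> u q i \<or> u p i < u q j" if "i \<in> N" for i using that by force
    \<comment> \<open>The highest rank at which a loss can start. The subtraction is not truncated,
      since the gain of \<open>j\<close> makes \<open>r (u q j)\<close> positive.\<close>
    define w where "w = r (u q j) - 1"
    have "r (u p j) < r (u q j)"
      using r_strict gain V p(1) q j by (auto simp: strict_mono_on_def)
    then have w: "r (u q j) = Suc w" "r (u p j) \<le> w" by (auto simp: w_def)
    \<comment> \<open>A losing agent forfeits at most its whole old term, whose exponent is at most
      \<open>w\<close>.\<close>
    have le: "B ^ r (u p i) \<le> B ^ r (u q i) + B ^ w" if i: "i \<in> N" for i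
      using H[OF i]
    proof
      assume "u p i \<le> u q i"
      then have "r (u p i) \<le> r (u q i)"
        using r_mono V p(1) q i by (auto simp: mono_on_def)
      then have "B ^ r (u p i) \<le> B ^ r (u q i)"
        by (intro power_increasing) (auto simp: B_def)
      then show ?thesis by simp
    next
      assume "u p i < u q j"
      then have "r (u p i) < r (u q j)"
        using r_strict V p(1) q i j by (auto simp: strict_mono_on_def)
      then have "B ^ r (u p i) \<le> B ^ w"
        using w by (intro power_increasing) (auto simp: B_def)
      then show ?thesis by simp
    qed
    \<comment> \<open>Since \<open>B = card N + 1\<close>, the new term of \<open>j\<close> pays for
      its old one and for \<open>card N\<close> losses of size \<open>B ^ w\<close>.\<close>
    have j_le: "B ^ r (u p j) + card N * B ^ w \<le> B ^ r (u q j)"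
    proof -
      have "B ^ r (u p j) \<le> B ^ w" using w(2) by (intro power_increasing) (auto simp: B_def)
      moreover have "B ^ r (u q j) = B ^ w + card N * B ^ w" by (simp add: w(1) B_def)
      ultimately show ?thesis by simp
    qed
    have split: "\<Phi> p' = B ^ r (u p' j) + (\<Sum>i\<in>N - {j}. B ^ r (u p' i))" for p'
      unfolding \<Phi>_def using \<open>finite N\<close> j by (rule sum.remove)
    have "(\<Sum>i\<in>N - {j}. B ^ r (u p i)) \<le> (\<Sum>i\<in>N - {j}. B ^ r (u q i) + B ^ w)"
      using le by (intro sum_mono) auto
    also have "\<dots> = (\<Sum>i\<in>N - {j}. B ^ r (u q i)) + card (N - {j}) * B ^ w"
      by (simp add: sum.distrib)
    finally have "\<Phi> p + card N * B ^ w \<le> \<Phi> q + card (N - {j}) * B ^ w"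
      using j_le split[of p] split[of q] by linarith
    \<comment> \<open>Fewer than \<open>card N\<close> agents other than \<open>j\<close> can lose,
      so a surplus remains, against the maximality of \<open>\<Phi> p\<close>.\<close>
    moreover have "card (N - {j}) * B ^ w < card N * B ^ w"
      using card_Diff1_less[OF \<open>finite N\<close> j] by (simp add: B_def)
    ultimately show False using p(2)[OF q] by linarith
  qed
  then show ?thesis using p(1) by blast
qed

lemma coalition_of_eq:
  assumes "partition_on N \<pi>" "C \<in> \<pi>" "i \<in> C"
  shows "coalition_of \<pi> i = C"
  unfolding coalition_of_def
  using assms by (intro the_equality) (auto dest: partition_onD2 disjointD)

lemma coalition_of_in:
  assumes "partition_on N \<pi>" "i \<in> N"
  shows "coalition_of \<pi> i \<in> \<pi>" "i \<in> coalition_of \<pi> i"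
  using assms coalition_of_eq[OF assms(1)] by (auto dest!: partition_onD1)

lemma joint_utility_mono:
  assumes "finite D" "C \<subseteq> D" "\<And>i s. i \<in> D \<Longrightarrow> s \<in> S \<Longrightarrow> 0 \<le> e i s"
  shows "joint_utility S e C \<le> joint_utility S e D"
proof (cases "C = {}")
  case True
  \<comment> \<open>The value 0 of the empty set is a convention, not a maximum; nonnegative
    expertise puts it below all others.\<close>
  have "0 \<le> joint_expertise e D s" if "D \<noteq> {}" "s \<in> S" for s
  proof -
    from \<open>D \<noteq> {}\<close> obtain i where "i \<in> D" by blast
    then have "0 \<le> e i s" "e i s \<le> joint_expertise e D s"
      using assms \<open>s \<in> S\<close> by (auto simp: joint_expertise_def)
    then show ?thesis by simp
  qed
  with True show ?thesis by (auto simp: joint_utility_def intro: sum_nonneg)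
next
  case False
  then have "joint_expertise e C s \<le> joint_expertise e D s" for s
    unfolding joint_expertise_def using assms by (intro Max_mono) auto
  with False \<open>C \<subseteq> D\<close> show ?thesis by (auto simp: joint_utility_def intro: sum_mono)
qed

text \<open>The deviation in which the members of \<open>D\<close> leave their coalitions to form
  \<open>D\<close>. Remainders left empty are dropped, as a partition has no empty block.\<close>

definition carve :: "'a set \<Rightarrow> 'a set set \<Rightarrow> 'a set set" where
  "carve D \<pi> = insert D ((\<lambda>A. A - D) ` \<pi> - {{}})"

lemma coalition_partition_carve:
  assumes "finite N" "coalition_partition N \<kappa> \<pi>" "coalition N \<kappa> D"
  shows "coalition_partition N \<kappa> (carve D \<pi>)"
  unfolding coalition_partition_def
proof (intro conjI ballI)
  have part: "partition_on N \<pi>" and coal: "\<And>A. A \<in> \<pi> \<Longrightarrow> coalition N \<kappa> A"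
    using assms(2) by (auto simp: coalition_partition_def)
  have "D \<noteq> {}" "D \<subseteq> N" using assms(3) by (auto simp: coalition_def)
  show "partition_on N (carve D \<pi>)"
  proof (rule partition_onI)
    show "\<Union> (carve D \<pi>) = N"
      using partition_onD1[OF part] \<open>D \<subseteq> N\<close> by (auto simp: carve_def)
  next
    fix A A' assume "A \<in> carve D \<pi>" "A' \<in> carve D \<pi>" "A \<noteq> A'"
    then show "disjnt A A'"
      using partition_onD2[OF part] by (auto simp: carve_def disjnt_def dest: disjointD)
  next
    show "{} \<notin> carve D \<pi>" using \<open>D \<noteq> {}\<close> by (auto simp: carve_def)
  qed
  fix A assume "A \<in> carve D \<pi>"
  then consider "A = D" | A' where "A' \<in> \<pi>" "A = A' - D" "A \<noteq> {}"
    by (auto simp: carve_def)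
  then show "coalition N \<kappa> A"
  proof cases
    case 2
    then have "A' \<subseteq> N" "card A' \<le> \<kappa>" using coal by (auto simp: coalition_def)
    moreover have "card A \<le> card A'"
      using 2 \<open>A' \<subseteq> N\<close> \<open>finite N\<close> by (intro card_mono) (auto intro: finite_subset)
    ultimately show ?thesis using 2 by (auto simp: coalition_def)
  qed (use assms(3) in simp)
qed

lemma coalition_of_carve:
  assumes "finite N" "coalition_partition N \<kappa> \<pi>" "coalition N \<kappa> D" "i \<in> N"
  shows "coalition_of (carve D \<pi>) i = (if i \<in> D then D else coalition_of \<pi> i - D)"
proof -
  have "partition_on N (carve D \<pi>)"
    using coalition_partition_carve[OF assms(1-3)] by (simp add: coalition_partition_def)
  moreover have "coalition_of \<pi> i \<in> \<pi>" "i \<in> coalition_of \<pi> i"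
    using assms coalition_of_in by (auto simp: coalition_partition_def)
  ultimately show ?thesis
    by (intro coalition_of_eq[of N]) (auto simp: carve_def)
qed

theorem corollary1:
  fixes N :: "'a set" and S :: "'s set" and e :: "'a \<Rightarrow> 's \<Rightarrow> real" and \<kappa> :: nat
  assumes "hedonic_expertise_game N S e \<kappa>"
  shows "\<exists>\<pi>. coalition_partition N \<kappa> \<pi> \<and> nash_stable N S e \<kappa> \<pi> \<and>
             core_stable N S e \<kappa> \<pi> \<and> pareto_optimal N S e \<kappa> \<pi>"
proof -
  let ?U = "joint_utility S e" and ?u = "agent_utility S e"
  let ?P = "{\<pi>. coalition_partition N \<kappa> \<pi>}"
  have N: "finite N" and e: "\<And>i s. i \<in> N \<Longrightarrow> s \<in> S \<Longrightarrow> 0 \<le> e i s" and "0 < \<kappa>"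
    using assms by (auto simp: hedonic_expertise_game_def)
  have "?P \<subseteq> Pow (Pow N)" by (auto simp: coalition_partition_def coalition_def)
  then have "finite ?P" using N by (meson finite_Pow_iff finite_subset)
  \<comment> \<open>The singletons show that there is a partition to choose from.\<close>
  moreover have "(\<lambda>i. {i}) ` N \<in> ?P"
    using \<open>0 < \<kappa>\<close>
    by (auto simp: coalition_partition_def coalition_def partition_on_def disjoint_def)
  ultimately obtain \<pi> where \<pi>: "coalition_partition N \<kappa> \<pi>" and leximax:
    "\<And>\<pi>' j. coalition_partition N \<kappa> \<pi>' \<Longrightarrow> j \<in> N \<Longrightarrow> ?u \<pi> j < ?u \<pi>' j \<Longrightarrow>
       \<exists>i\<in>N. ?u \<pi>' i < ?u \<pi> i \<and> ?u \<pi>' j \<le> ?u \<pi> i"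
    using ex_leximax[OF N, of ?P ?u] by blast
  have part: "partition_on N \<pi>" using \<pi> by (simp add: coalition_partition_def)
  \<comment> \<open>The second alternative in \<open>meet\<close> serves the Nash move, where the
    coalition joined may be worth exactly as much as \<open>D\<close>.\<close>
  have no_gain: "\<not> ?u \<pi> j < ?U D"
    if D: "coalition N \<kappa> D" and "j \<in> D"
      and meet: "\<And>A. A \<in> \<pi> \<Longrightarrow> A \<inter> D \<noteq> {} \<Longrightarrow> ?U A < ?U D \<or> A \<subseteq> D \<and> ?U A \<le> ?U D" for D j
  proof
    assume less: "?u \<pi> j < ?U D"
    note cof = coalition_of_carve[OF N \<pi> D]
    have "j \<in> N" using D \<open>j \<in> D\<close> by (auto simp: coalition_def)
    then have uj: "?u (carve D \<pi>) j = ?U D"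
      using cof \<open>j \<in> D\<close> by (simp add: agent_utility_def)
    then obtain i where i: "i \<in> N" "?u (carve D \<pi>) i < ?u \<pi> i" "?U D \<le> ?u \<pi> i"
      using leximax[OF coalition_partition_carve[OF N \<pi> D] \<open>j \<in> N\<close>] less by auto
    define A where "A = coalition_of \<pi> i"
    have A: "A \<in> \<pi>" "i \<in> A" "?U D \<le> ?U A"
      using coalition_of_in[OF part i(1)] i(3) by (auto simp: A_def agent_utility_def)
    show False
    \<comment> \<open>The loser \<open>i\<close> cannot exist: a coalition \<open>A\<close> disjoint
      from \<open>D\<close> survives intact, and one that meets \<open>D\<close> is absorbed without
      loss, because \<open>?U D \<le> ?U A\<close> excludes the strict alternative.\<close>
    proof (cases "A \<inter> D = {}")
      case True
      then have "coalition_of (carve D \<pi>) i = A"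
        using cof[OF i(1)] A(2) by (auto simp: A_def)
      then show False using i(2) by (simp add: A_def agent_utility_def)
    next
      case False
      then have "A \<subseteq> D" "?U A \<le> ?U D" using meet A by force+
      then have "?u (carve D \<pi>) i = ?U D"
        using cof[OF i(1)] A(2) by (auto simp: agent_utility_def)
      then show False
        using i(2) \<open>?U A \<le> ?U D\<close> by (simp add: A_def agent_utility_def)
    qed
  qed
  have "nash_stable N S e \<kappa> \<pi>"
    unfolding nash_stable_def
  proof (intro ballI impI)
    fix i C assume i: "i \<in> N" and C: "C \<in> \<pi>" "card C < \<kappa>"
    have "C \<subseteq> N" using \<pi> C(1) by (auto simp: coalition_partition_def coalition_def)
    then have D: "coalition N \<kappa> (C \<union> {i})"
      using i C(2) finite_subset[OF _ N] by (auto simp: coalition_def card_insert_if)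
    have le: "?U C \<le> ?U (C \<union> {i})"
      using \<open>C \<subseteq> N\<close> i N e by (intro joint_utility_mono) (auto intro: finite_subset)
    show "?U (C \<union> {i}) \<le> ?U (coalition_of \<pi> i)"
    proof (rule ccontr)
      assume "\<not> ?thesis"
      then have less: "?u \<pi> i < ?U (C \<union> {i})" by (simp add: agent_utility_def)
      \<comment> \<open>Only two coalitions can meet \<open>C \<union> {i}\<close>: the old one of
        \<open>i\<close>, worth less because the move improves, and \<open>C\<close>, worth no more
        by monotonicity.\<close>
      have "?U A < ?U (C \<union> {i}) \<or> A \<subseteq> C \<union> {i} \<and> ?U A \<le> ?U (C \<union> {i})"
        if A: "A \<in> \<pi>" "A \<inter> (C \<union> {i}) \<noteq> {}" for A
      proof (cases "i \<in> A")
        case True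
        then show ?thesis
          using less coalition_of_eq[OF part A(1)] by (simp add: agent_utility_def)
      next
        case False
        then have "A = C" using A C(1) partition_onD2[OF part] by (auto dest: disjointD)
        then show ?thesis using le by auto
      qed
      then show False using no_gain[OF D, of i] less by blast
    qed
  qed
  moreover have "core_stable N S e \<kappa> \<pi>"
    unfolding core_stable_def
  proof
    assume "\<exists>D. coalition N \<kappa> D \<and> blocks S e D \<pi>"
    then obtain D where D: "coalition N \<kappa> D" and blk: "\<And>i. i \<in> D \<Longrightarrow> ?u \<pi> i < ?U D"
      by (auto simp: blocks_def)
    then obtain j where "j \<in> D" by (auto simp: coalition_def)
    \<comment> \<open>A common member of \<open>A\<close> and \<open>D\<close> has utility
      \<open>?U A\<close> and strictly prefers \<open>D\<close>.\<close>
    have "?U A < ?U D" if "A \<in> \<pi>" "A \<inter> D \<noteq> {}" for A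
      using that blk coalition_of_eq[OF part that(1)] by (auto simp: agent_utility_def)
    then show False using no_gain[OF D \<open>j \<in> D\<close>] blk[OF \<open>j \<in> D\<close>] by blast
  qed
  \<comment> \<open>By \<open>leximax\<close> any gainer comes with a loser, whereas Pareto
    dominance allows none.\<close>
  moreover have "pareto_optimal N S e \<kappa> \<pi>"
    unfolding pareto_optimal_def pareto_dominates_def using leximax by (meson linorder_not_le)
  ultimately show ?thesis using \<pi> by blast
qed

end
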